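(* Let $m\ge 1$, let $(p_i(n))_{n\ge 0}$, $1\le i\le m$, be sequences of nonnegative real numbers with $\sum_{i=1}^m p_i(n)<1$ for all $n\ge 0$, and let $(\tau_i(n))_{n\ge 0}$, $1\le i\le m$, be sequences of integers such that $\tau_i(n)\le n-1$ for all $n\ge 0$ and $\lim_{n\to\infty}\tau_i(n)=\infty$, $1\le i\le m$. Let $\varphi(n)=\max_{1\le i\le m}\max_{0\le s\le n}\tau_i(s)$ for $n\ge 0$, and let $a_r(n,k)$ be defined by $$a_1(n,k)=\prod_{i=k}^{n-1}\Big[1-\sum_{\ell=1}^m p_\ell(i)\Big],\qquad a_{r+1}(n,k)=\prod_{i=k}^{n-1}\Big[1-\sum_{\ell=1}^m p_\ell(i)\,a_r^{-1}(i,\tau_\ell(i))\Big],\quad r\in\mathbb{N}.$$ If for some $r\in\mathbb{N}$ $$\limsup_{n\to\infty}\sum_{j=\varphi(n)}^{n}\sum_{i=1}^{m}p_i(j)\,a_r^{-1}(\varphi(n),\tau_i(j))>1,$$ then all solutions of the difference equation $$\Delta x(n)+\sum_{i=1}^m p_i(n)\,x(\tau_i(n))=0,\qquad n\ge 0,$$ oscillate.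
   Context: $\mathbb{N}=\{1,2,\dots\}$. $\Delta x(n)=x(n+1)-x(n)$. Let $w=-\min_{n\ge0,\,1\le i\le m}\tau_i(n)$ (a finite positive integer). A solution of the equation is a real sequence $(x(n))_{n\ge -w}$ satisfying the equation for all $n\ge 0$. A solution is oscillatory (oscillates) if it is neither eventually positive nor eventually negative. Empty products equal $1$, and $a_r^{-1}(n,k)$ means $1/a_r(n,k)$. For fixed $r$, only values of $a_r(n,k)$ with large $n,k$ matter for the limsup, since $\tau_i(n)\to\infty$; then all indices occurring are nonnegative. *)

theory Defs
  imports Complex_Main "HOL-Library.Liminf_Limsup" "HOL-Library.Extended_Real"
begin

text \<open>
  The coefficients \<open>p i n\<close> and the arguments \<open>\<tau> i n\<close> are indexed by \<open>n :: nat\<close>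
  (and \<open>i \<in> {1..m}\<close>). The values of \<open>\<tau>\<close>, the indices of solutions and the two
  arguments of \<open>a_seq\<close> are integers, since \<open>\<tau> i n\<close> is negative for small \<open>n\<close>.
\<close>

definition phi :: "nat \<Rightarrow> (nat \<Rightarrow> nat \<Rightarrow> int) \<Rightarrow> nat \<Rightarrow> int" where
  "phi m \<tau> n = (MAX i\<in>{1..m}. MAX s\<in>{0..n}. \<tau> i s)"

text \<open>
  The index \<open>r\<close> ranges over the positive integers; the value at \<open>0\<close> is a dummy.
  At a negative index \<open>i\<close>, where the sequences are not defined, \<open>nat i = 0\<close>; this
  only affects \<open>a_seq m p \<tau> r n k\<close> for small (for fixed \<open>r\<close>) \<open>k\<close>. A reciprocal
  \<open>1 / a_seq \<dots>\<close> of zero is \<open>0\<close>, as always in HOL.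
\<close>

fun a_seq :: "nat \<Rightarrow> (nat \<Rightarrow> nat \<Rightarrow> real) \<Rightarrow> (nat \<Rightarrow> nat \<Rightarrow> int) \<Rightarrow> nat \<Rightarrow> int \<Rightarrow> int \<Rightarrow> real" where
  "a_seq m p \<tau> 0 n k = 1"
| "a_seq m p \<tau> (Suc 0) n k = (\<Prod>i\<in>{k..<n}. 1 - (\<Sum>l=1..m. p l (nat i)))"
| "a_seq m p \<tau> (Suc (Suc r)) n k =
     (\<Prod>i\<in>{k..<n}. 1 - (\<Sum>l=1..m. p l (nat i) * (1 / a_seq m p \<tau> (Suc r) i (\<tau> l (nat i)))))"

definition fwd_diff :: "(int \<Rightarrow> real) \<Rightarrow> int \<Rightarrow> real" where
  "fwd_diff x n = x (n + 1) - x n"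

definition max_delay :: "nat \<Rightarrow> (nat \<Rightarrow> nat \<Rightarrow> int) \<Rightarrow> int" where
  "max_delay m \<tau> = - Inf {\<tau> i n | i n. i \<in> {1..m}}"

text \<open>
  Solutions are sequences on \<open>{- max_delay m \<tau>..}\<close>. They are represented by total
  functions on the integers, whose values below \<open>- max_delay m \<tau>\<close> are irrelevant;
  see \<open>is_solution_cong\<close> and \<open>oscillatory_cong\<close>.
\<close>

definition is_solution ::
  "nat \<Rightarrow> (nat \<Rightarrow> nat \<Rightarrow> real) \<Rightarrow> (nat \<Rightarrow> nat \<Rightarrow> int) \<Rightarrow> (int \<Rightarrow> real) \<Rightarrow> bool" where
  "is_solution m p \<tau> x \<longleftrightarrow>
     (\<forall>n::nat. fwd_diff x (int n) + (\<Sum>i=1..m. p i n * x (\<tau> i n)) = 0)"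

definition oscillatory :: "(int \<Rightarrow> real) \<Rightarrow> bool" where
  "oscillatory x \<longleftrightarrow>
     \<not> (\<forall>\<^sub>F n in at_top. x n > 0) \<and> \<not> (\<forall>\<^sub>F n in at_top. x n < 0)"

lemma tau_ge_max_delay:
  fixes \<tau> :: "nat \<Rightarrow> nat \<Rightarrow> int"
  assumes lim: "\<And>i. i \<in> {1..m} \<Longrightarrow> filterlim (\<tau> i) at_top sequentially"
    and i: "i \<in> {1..m}"
  shows "- max_delay m \<tau> \<le> \<tau> i n"
proof -
  have "bdd_below (range (\<tau> l))" if l: "l \<in> {1..m}" for l
  proof -
    obtain N where N: "\<And>n. n \<ge> N \<Longrightarrow> \<tau> l n \<ge> 0"
      using lim[OF l] unfolding filterlim_at_top eventually_sequentially by blast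
    have "range (\<tau> l) \<subseteq> \<tau> l ` {..<N} \<union> {0..}"
    proof (intro subsetI, elim rangeE)
      fix y n assume "y = \<tau> l n"
      then show "y \<in> \<tau> l ` {..<N} \<union> {0..}"
        using N[of n] by (cases "n < N") auto
    qed
    moreover have "bdd_below (\<tau> l ` {..<N} \<union> {0..})"
      by simp
    ultimately show ?thesis
      by (rule bdd_below_mono[rotated])
  qed
  then have "bdd_below (\<Union>l\<in>{1..m}. range (\<tau> l))"
    by (subst bdd_below_UN) auto
  also have "(\<Union>l\<in>{1..m}. range (\<tau> l)) = {\<tau> i n | i n. i \<in> {1..m}}"
    by blast
  finally have "Inf {\<tau> i n | i n. i \<in> {1..m}} \<le> \<tau> i n"
    using i by (intro cInf_lower) blast+
  then show ?thesis
    by (simp add: max_delay_def)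
qed

lemma is_solution_cong:
  fixes \<tau> :: "nat \<Rightarrow> nat \<Rightarrow> int"
  assumes m: "m \<ge> 1"
    and le: "\<And>i n. i \<in> {1..m} \<Longrightarrow> \<tau> i n \<le> int n - 1"
    and lim: "\<And>i. i \<in> {1..m} \<Longrightarrow> filterlim (\<tau> i) at_top sequentially"
    and eq: "\<And>n. n \<ge> - max_delay m \<tau> \<Longrightarrow> x n = y n"
  shows "is_solution m p \<tau> x \<longleftrightarrow> is_solution m p \<tau> y"
proof -
  have ge: "- max_delay m \<tau> \<le> \<tau> i n" if "i \<in> {1..m}" for i n
    using lim that by (rule tau_ge_max_delay)
  have "- max_delay m \<tau> \<le> 0"
    using ge[of 1 0] le[of 1 0] m by simp
  then have "fwd_diff x (int n) = fwd_diff y (int n)" for n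
    by (simp add: fwd_diff_def eq)
  moreover have "(\<Sum>i=1..m. p i n * x (\<tau> i n)) = (\<Sum>i=1..m. p i n * y (\<tau> i n))" for n
    using ge by (intro sum.cong refl) (simp add: eq)
  ultimately show ?thesis
    by (simp add: is_solution_def)
qed

lemma oscillatory_cong:
  assumes "\<And>n. n \<ge> N \<Longrightarrow> x n = y n"
  shows "oscillatory x \<longleftrightarrow> oscillatory y"
proof -
  have "\<forall>\<^sub>F n in at_top. x n = y n"
    using assms by (auto simp: eventually_at_top_linorder)
  then have "(\<forall>\<^sub>F n in at_top. x n > 0) = (\<forall>\<^sub>F n in at_top. y n > 0)"
    "(\<forall>\<^sub>F n in at_top. x n < 0) = (\<forall>\<^sub>F n in at_top. y n < 0)"
    by (auto intro!: eventually_subst elim!: eventually_mono)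
  then show ?thesis
    by (simp add: oscillatory_def)
qed

end

theory Submission
  imports Defs
begin

text \<open>
  An eventually positive solution \<open>x\<close> is eventually nonincreasing. If
  \<open>x (\<tau> l i) \<ge> x i / a\<^sub>r(i, \<tau> l i)\<close>, the equation gives
  \<open>x (i + 1) \<le> x i * (1 - (\<Sum>l. p l i / a\<^sub>r(i, \<tau> l i)))\<close>, and multiplying these
  one-step bounds yields \<open>x n \<le> a\<^sub>r\<^sub>+\<^sub>1(n, k) * x k\<close> for large \<open>k \<le> n\<close>; the factors are
  positive because \<open>x\<close> is. Summing the equation over \<open>j\<close> from \<open>\<phi>(n)\<close> to \<open>n\<close> and using
  \<open>x (\<tau> i j) \<ge> x (\<phi>(n)) / a\<^sub>r(\<phi>(n), \<tau> i j)\<close> shows that the sums in the limsup are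
  eventually smaller than \<open>1\<close>.
\<close>

text \<open>The dummy \<open>a_seq m p \<tau> 0 = 1\<close> makes the recursion uniform, starting at \<open>r = 0\<close>.\<close>

lemma a_seq_Suc:
  "a_seq m p \<tau> (Suc r) n k =
     (\<Prod>i\<in>{k..<n}. 1 - (\<Sum>l=1..m. p l (nat i) * (1 / a_seq m p \<tau> r i (\<tau> l (nat i)))))"
  by (cases r) simp_all

text \<open>One-step bounds multiply up along the interval; nonnegative factors allow the induction
  hypothesis to be multiplied by \<open>c n\<close>.\<close>

lemma le_prod_mult:
  fixes x c :: "int \<Rightarrow> real"
  assumes "k \<le> n"
    and "\<And>i. k \<le> i \<Longrightarrow> i < n \<Longrightarrow> 0 \<le> c i"
    and "\<And>i. k \<le> i \<Longrightarrow> i < n \<Longrightarrow> x (i + 1) \<le> c i * x i"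
  shows "x n \<le> (\<Prod>i\<in>{k..<n}. c i) * x k"
  using assms
proof (induction n rule: int_ge_induct)
  case base
  then show ?case by simp
next
  case (step n)
  have "{k..<n + 1} = insert n {k..<n}"
    using step.hyps by auto
  then have prod: "(\<Prod>i\<in>{k..<n + 1}. c i) = c n * (\<Prod>i\<in>{k..<n}. c i)"
    by simp
  have "x (n + 1) \<le> c n * x n"
    using step.hyps step.prems(2)[of n] by simp
  also have "\<dots> \<le> c n * ((\<Prod>i\<in>{k..<n}. c i) * x k)"
    using step.hyps step.prems by (intro mult_left_mono step.IH) auto
  finally show ?case
    by (simp add: prod mult.assoc)
qed

lemma fwd_diff_sum:
  assumes "k \<le> n + 1"
  shows "(\<Sum>j\<in>{k..n}. fwd_diff x j) = x (n + 1) - x k"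
proof -
  \<comment> \<open>Induction on the exclusive upper end makes the base case an empty sum; the claim
    is the instance \<open>n + 1\<close>.\<close>
  have "(\<Sum>j\<in>{k..n - 1}. fwd_diff x j) = x n - x k" if "k \<le> n" for n
    using that
  proof (induction n rule: int_ge_induct)
    case base
    then show ?case by simp
  next
    case (step n)
    then have "{k..n + 1 - 1} = insert n {k..n - 1}"
      by auto
    then show ?case
      using step.IH by (simp add: fwd_diff_def)
  qed
  from this[of "n + 1"] assms show ?thesis by simp
qed

text \<open>By linearity, excluding eventually negative solutions reduces to excluding eventually
  positive ones.\<close>

lemma is_solution_uminus:
  assumes "is_solution m p \<tau> x"
  shows "is_solution m p \<tau> (\<lambda>n. - x n)"
  unfolding is_solution_def
proof
  fix n
  have "fwd_diff x (int n) + (\<Sum>i=1..m. p i n * x (\<tau> i n)) = 0"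
    using assms by (simp add: is_solution_def)
  then show "fwd_diff (\<lambda>n. - x n) (int n) + (\<Sum>i=1..m. p i n * - x (\<tau> i n)) = 0"
    by (simp add: fwd_diff_def sum_negf)
qed

lemma is_solutionD:
  assumes "is_solution m p \<tau> x" and "j \<ge> 0"
  shows "fwd_diff x j = - (\<Sum>i=1..m. p i (nat j) * x (\<tau> i (nat j)))"
proof -
  have "fwd_diff x (int (nat j)) + (\<Sum>i=1..m. p i (nat j) * x (\<tau> i (nat j))) = 0"
    using assms(1) unfolding is_solution_def by blast
  then show ?thesis
    using assms(2) by (simp add: eq_neg_iff_add_eq_0)
qed

text \<open>A single threshold controls both the index \<open>j\<close> and its delayed arguments;
  as it is nonnegative, \<open>nat j\<close> loses nothing.\<close>

lemma delays_eventually_ge: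
  fixes \<tau> :: "nat \<Rightarrow> nat \<Rightarrow> int"
  assumes "\<And>i. i \<in> {1..m} \<Longrightarrow> filterlim (\<tau> i) at_top sequentially"
  shows "\<exists>M\<ge>max K 0. \<forall>i\<in>{1..m}. \<forall>j\<ge>M. \<tau> i (nat j) \<ge> K"
proof -
  have "\<forall>\<^sub>F n in sequentially. \<forall>i\<in>{1..m}. \<tau> i n \<ge> K"
    using assms by (intro eventually_ball_finite) (auto simp: filterlim_at_top)
  then obtain N where N: "\<And>n i. n \<ge> N \<Longrightarrow> i \<in> {1..m} \<Longrightarrow> \<tau> i n \<ge> K"
    unfolding eventually_sequentially by blast
  show ?thesis
    by (rule exI[of _ "max K (int N)"]) (auto intro!: N)
qed

lemma tau_le_phi:
  assumes "i \<in> {1..m}" and "s \<le> n"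
  shows "\<tau> i s \<le> phi m \<tau> n"
proof -
  have "\<tau> i s \<le> (MAX s\<in>{0..n}. \<tau> i s)"
    using assms by (intro Max_ge) auto
  also have "\<dots> \<le> phi m \<tau> n"
    unfolding phi_def using assms by (intro Max_ge) auto
  finally show ?thesis .
qed

lemma phi_le:
  assumes "m \<ge> 1" and "\<And>i n. i \<in> {1..m} \<Longrightarrow> \<tau> i n \<le> int n - 1"
  shows "phi m \<tau> n \<le> int n - 1"
proof -
  have "\<tau> i s \<le> int n - 1" if "i \<in> {1..m}" "s \<le> n" for i s
    using assms(2)[OF that(1), of s] that(2) by linarith
  then show ?thesis
    unfolding phi_def using assms(1) by (intro Max.boundedI) (auto simp del: One_nat_def)
qed

lemma filterlim_phi:
  assumes "m \<ge> 1"
    and "\<And>i. i \<in> {1..m} \<Longrightarrow> filterlim (\<tau> i) at_top sequentially"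
  shows "filterlim (phi m \<tau>) at_top sequentially"
proof (rule filterlim_at_top_mono)
  show "filterlim (\<tau> 1) at_top sequentially"
    using assms by simp
  show "\<forall>\<^sub>F n in sequentially. \<tau> 1 n \<le> phi m \<tau> n"
    using assms(1) by (intro always_eventually allI tau_le_phi) auto
qed

text \<open>Positivity of \<open>a_seq\<close> is carried through the induction because the next
  stage divides by it. \<open>K\<close> depends on \<open>r\<close>: at each stage the delayed
  arguments must lie beyond the previous threshold.\<close>

lemma positive_solution_le_a_seq:
  fixes \<tau> :: "nat \<Rightarrow> nat \<Rightarrow> int"
  assumes p: "\<And>i n. i \<in> {1..m} \<Longrightarrow> p i n \<ge> 0"
    and le: "\<And>i n. i \<in> {1..m} \<Longrightarrow> \<tau> i n \<le> int n - 1"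
    and lim: "\<And>i. i \<in> {1..m} \<Longrightarrow> filterlim (\<tau> i) at_top sequentially"
    and sol: "is_solution m p \<tau> x"
    and pos: "\<forall>\<^sub>F n in at_top. x n > 0"
  shows "\<exists>K. \<forall>k\<ge>K. \<forall>n\<ge>k. 0 < a_seq m p \<tau> r n k \<and> x n \<le> a_seq m p \<tau> r n k * x k"
proof (induction r)
  case 0
  obtain N where N: "\<And>n. n \<ge> N \<Longrightarrow> x n > 0"
    using pos by (auto simp: eventually_at_top_linorder)
  obtain M where M: "M \<ge> 0" "\<And>i j. i \<in> {1..m} \<Longrightarrow> j \<ge> M \<Longrightarrow> \<tau> i (nat j) \<ge> N"
    using delays_eventually_ge[of m \<tau> N, OF lim] by fastforce
  \<comment> \<open>As \<open>a_seq\<close> is 1 at \<open>r = 0\<close>, the claim is that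
    \<open>x\<close> is eventually nonincreasing, which holds once the delayed values are
    positive.\<close>
  have dec: "x (j + 1) \<le> 1 * x j" if "j \<ge> M" for j
  proof -
    have "(\<Sum>i=1..m. p i (nat j) * x (\<tau> i (nat j))) \<ge> 0"
      using p M(2)[OF _ that] N by (intro sum_nonneg mult_nonneg_nonneg) (auto intro: less_imp_le)
    then show ?thesis
      using is_solutionD[OF sol, of j] that M(1) by (simp add: fwd_diff_def)
  qed
  have "x n \<le> x k" if "M \<le> k" "k \<le> n" for k n
    using le_prod_mult[OF that(2), of "\<lambda>_. 1" x] dec that(1) by simp
  then show ?case by auto
next
  case (Suc r)
  then obtain K where K: "\<And>k n. k \<ge> K \<Longrightarrow> n \<ge> k \<Longrightarrow>
      0 < a_seq m p \<tau> r n k \<and> x n \<le> a_seq m p \<tau> r n k * x k"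
    by blast
  obtain N where N: "\<And>n. n \<ge> N \<Longrightarrow> x n > 0"
    using pos by (auto simp: eventually_at_top_linorder)
  obtain M where M: "M \<ge> max K N" "M \<ge> 0"
      "\<And>i j. i \<in> {1..m} \<Longrightarrow> j \<ge> M \<Longrightarrow> \<tau> i (nat j) \<ge> max K N"
    using delays_eventually_ge[of m \<tau> "max K N", OF lim] by fastforce
  define c where "c j = 1 - (\<Sum>l=1..m. p l (nat j) * (1 / a_seq m p \<tau> r j (\<tau> l (nat j))))" for j
  have step: "0 < c j \<and> x (j + 1) \<le> c j * x j" if j: "j \<ge> M" for j
  proof -
    have "(\<Sum>l=1..m. p l (nat j) * (1 / a_seq m p \<tau> r j (\<tau> l (nat j)))) * x j
        \<le> (\<Sum>l=1..m. p l (nat j) * x (\<tau> l (nat j)))"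
      unfolding sum_distrib_right
    proof (rule sum_mono)
      fix l assume l: "l \<in> {1..m}"
      \<comment> \<open>The induction hypothesis is used between the delayed argument and
        \<open>j\<close>; division by the positive \<open>a_seq\<close> makes it a lower bound for
        the delayed value.\<close>
      have "\<tau> l (nat j) \<ge> K" "\<tau> l (nat j) \<le> j"
        using M(3)[OF l j] le[OF l, of "nat j"] j M(2) by auto
      from K[OF this] have "1 / a_seq m p \<tau> r j (\<tau> l (nat j)) * x j \<le> x (\<tau> l (nat j))"
        by (simp add: field_simps)
      then show "p l (nat j) * (1 / a_seq m p \<tau> r j (\<tau> l (nat j))) * x j
          \<le> p l (nat j) * x (\<tau> l (nat j))"
        using p[OF l] by (simp only: mult.assoc mult_left_mono)
    qed
    then have le: "x (j + 1) \<le> c j * x j"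
      using is_solutionD[OF sol, of j] j M(2) by (simp add: fwd_diff_def c_def left_diff_distrib)
    \<comment> \<open>The sign of \<open>c j\<close> is forced by the solution:
      \<open>0 < x (j + 1) \<le> c j * x j\<close>.\<close>
    moreover have "0 < x (j + 1)" "0 < x j"
      using N j M(1) by auto
    ultimately have "0 < c j * x j"
      by linarith
    with \<open>0 < x j\<close> have "0 < c j"
      by (simp add: zero_less_mult_iff)
    with le show ?thesis by blast
  qed
  have "0 < a_seq m p \<tau> (Suc r) n k \<and> x n \<le> a_seq m p \<tau> (Suc r) n k * x k"
    if "M \<le> k" "k \<le> n" for k n
    unfolding a_seq_Suc c_def[symmetric]
    using that step by (intro conjI prod_pos le_prod_mult) (auto intro: less_imp_le)
  then show ?case by blast
qed

text \<open>The contrapositive of the criterion, for eventually positive solutions: the sums are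
  eventually at most 1.\<close>

lemma limsup_le_1_if_positive_solution:
  fixes \<tau> :: "nat \<Rightarrow> nat \<Rightarrow> int"
  assumes m: "m \<ge> 1"
    and p: "\<And>i n. i \<in> {1..m} \<Longrightarrow> p i n \<ge> 0"
    and le: "\<And>i n. i \<in> {1..m} \<Longrightarrow> \<tau> i n \<le> int n - 1"
    and lim: "\<And>i. i \<in> {1..m} \<Longrightarrow> filterlim (\<tau> i) at_top sequentially"
    and sol: "is_solution m p \<tau> x"
    and pos: "\<forall>\<^sub>F n in at_top. x n > 0"
  shows "limsup (\<lambda>n. ereal (\<Sum>j\<in>{phi m \<tau> n..int n}. \<Sum>i=1..m.
           p i (nat j) * (1 / a_seq m p \<tau> r (phi m \<tau> n) (\<tau> i (nat j))))) \<le> 1"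
proof (rule Limsup_bounded)
  obtain K where K: "\<And>k n. k \<ge> K \<Longrightarrow> n \<ge> k \<Longrightarrow>
      0 < a_seq m p \<tau> r n k \<and> x n \<le> a_seq m p \<tau> r n k * x k"
    using positive_solution_le_a_seq[OF p le lim sol pos] by blast
  obtain N where N: "\<And>n. n \<ge> N \<Longrightarrow> x n > 0"
    using pos by (auto simp: eventually_at_top_linorder)
  obtain M where M: "M \<ge> max K N" "M \<ge> 0"
      "\<And>i j. i \<in> {1..m} \<Longrightarrow> j \<ge> M \<Longrightarrow> \<tau> i (nat j) \<ge> max K N"
    using delays_eventually_ge[of m \<tau> "max K N", OF lim] by fastforce
  \<comment> \<open>This puts every \<open>j\<close> of the summation range beyond \<open>M\<close>,
    so the delayed arguments there lie beyond \<open>K\<close>.\<close>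
  have "\<forall>\<^sub>F n in sequentially. phi m \<tau> n \<ge> M"
    using filterlim_phi[OF m lim] by (simp add: filterlim_at_top)
  then show "\<forall>\<^sub>F n in sequentially. ereal (\<Sum>j\<in>{phi m \<tau> n..int n}. \<Sum>i=1..m.
      p i (nat j) * (1 / a_seq m p \<tau> r (phi m \<tau> n) (\<tau> i (nat j)))) \<le> 1"
  proof eventually_elim
    case (elim n)
    let ?f = "phi m \<tau> n"
    let ?S = "\<Sum>j\<in>{?f..int n}. \<Sum>i=1..m. p i (nat j) * (1 / a_seq m p \<tau> r ?f (\<tau> i (nat j)))"
    have fn: "?f \<le> int n + 1"
      using phi_le[of m \<tau> n, OF m le] by simp
    have "?S * x ?f \<le> (\<Sum>j\<in>{?f..int n}. \<Sum>i=1..m. p i (nat j) * x (\<tau> i (nat j)))"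
      unfolding sum_distrib_right
    proof (intro sum_mono)
      fix j i assume j: "j \<in> {?f..int n}" and i: "i \<in> {1..m}"
      have "\<tau> i (nat j) \<ge> K"
        using M(3)[OF i, of j] j elim by simp
      \<comment> \<open>Because \<open>phi\<close> is a maximum over all indices up to
        \<open>n\<close>, the fixed upper index \<open>?f\<close> can be used for every
        \<open>j\<close> in the range.\<close>
      moreover have "\<tau> i (nat j) \<le> ?f"
        using i j by (intro tau_le_phi) auto
      ultimately have "0 < a_seq m p \<tau> r ?f (\<tau> i (nat j)) \<and>
          x ?f \<le> a_seq m p \<tau> r ?f (\<tau> i (nat j)) * x (\<tau> i (nat j))"
        by (rule K)
      then have "1 / a_seq m p \<tau> r ?f (\<tau> i (nat j)) * x ?f \<le> x (\<tau> i (nat j))"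
        by (simp add: field_simps)
      then show "p i (nat j) * (1 / a_seq m p \<tau> r ?f (\<tau> i (nat j))) * x ?f
          \<le> p i (nat j) * x (\<tau> i (nat j))"
        using p[OF i] by (simp only: mult.assoc mult_left_mono)
    qed
    also have "\<dots> = - (\<Sum>j\<in>{?f..int n}. fwd_diff x j)"
      unfolding sum_negf[symmetric]
      using elim M(2) by (intro sum.cong refl) (simp add: is_solutionD[OF sol])
    also have "\<dots> = x ?f - x (int n + 1)"
      by (simp add: fwd_diff_sum[OF fn])
    \<comment> \<open>The positive term \<open>x (int n + 1)\<close> is dropped; the factor 1
      prepares the cancellation of \<open>x ?f\<close>.\<close>
    also have "\<dots> \<le> 1 * x ?f"
      using N[of "int n + 1"] fn elim M(1) by simp
    finally have "?S \<le> 1"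
      using N[of ?f] elim M(1) by (simp only: mult_le_cancel_right_pos)
    then show ?case by simp
  qed
qed

theorem theorem2p4:
  fixes m :: nat
    and p :: "nat \<Rightarrow> nat \<Rightarrow> real"
    and \<tau> :: "nat \<Rightarrow> nat \<Rightarrow> int"
  assumes "m \<ge> 1"
    and "\<And>i n. i \<in> {1..m} \<Longrightarrow> p i n \<ge> 0"
    and "\<And>n. (\<Sum>i=1..m. p i n) < 1"
    and "\<And>i n. i \<in> {1..m} \<Longrightarrow> \<tau> i n \<le> int n - 1"
    and "\<And>i. i \<in> {1..m} \<Longrightarrow> filterlim (\<tau> i) at_top sequentially"
    and "\<exists>r\<ge>1. limsup (\<lambda>n. ereal (\<Sum>j\<in>{phi m \<tau> n..int n}. \<Sum>i=1..m.
           p i (nat j) * (1 / a_seq m p \<tau> r (phi m \<tau> n) (\<tau> i (nat j))))) > 1"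
  shows "\<forall>x. is_solution m p \<tau> x \<longrightarrow> oscillatory x"
proof (intro allI impI)
  fix x assume sol: "is_solution m p \<tau> x"
  have not_pos: "\<not> (\<forall>\<^sub>F n in at_top. y n > 0)" if "is_solution m p \<tau> y" for y
  proof
    assume "\<forall>\<^sub>F n in at_top. y n > 0"
    note limsup_le = limsup_le_1_if_positive_solution[OF assms(1,2,4,5) that this]
    from assms(6) show False
      by (elim exE conjE) (rule notE[OF leD[OF limsup_le]])
  qed
  have "\<not> (\<forall>\<^sub>F n in at_top. x n < 0)"
    using not_pos[OF is_solution_uminus[OF sol]] by simp
  with not_pos[OF sol] show "oscillatory x"
    by (simp add: oscillatory_def)
qed

end
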